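(* Assume $A=S+R\in\mathbb R^{n\times m}$ is a mask decomposition, meaning $S\odot R=0$. For constants $\lambda_2,\lambda_1\ge0$, define $$\mathcal J(A):=\mathcal L_{\mathrm{CE}}(A)+\lambda_2\|A\|_F^2+\lambda_1\|A\|_1+\mathcal C,$$ where $\mathcal C$ contains all terms independent of $A$. Let $A_\theta:=S+\theta R$. Then for every $\theta\in[0,1]$, $$\mathcal J(A_\theta)-\mathcal J(A_1)\le(1-\theta)B_T(R)-\lambda_2(1-\theta^2)\|R\|_F^2-\lambda_1(1-\theta)\|R\|_1.$$ For full pruning, $$\mathcal J(S)\le\mathcal J(A)-\lambda_2\|R\|_F^2-\lambda_1\|R\|_1+B_T(R).$$ Consequently, the mask is certified to decrease the elastic-net objective (i.e. $\mathcal J(S)<\mathcal J(A)$) whenever $$B_T(R)<\lambda_2\|R\|_F^2+\lambda_1\|R\|_1.$$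
   Context: $T$ is a finite nonempty training set with correct classes $C(s)\in\{1,\dots,K\}$. A target layer $A\in\mathbb R^{n\times m}$ sits inside a network whose logits are $z_A(s):=\psi_2(A\psi_1(s))\in\mathbb R^K$, where $\psi_1$ (values in $\mathbb R^m$) and $\psi_2:\mathbb R^n\to\mathbb R^K$ are the pre- and post-layer maps with all other parameters frozen. The cross-entropy is $$\mathcal L_{\mathrm{CE}}(A):=\frac1{|T|}\sum_{s\in T}\Big[-z_A(s)_{C(s)}+\log\Big(\sum_{j=1}^K e^{z_A(s)_j}\Big)\Big].$$ For $A=S+R$ and $A_\theta=S+\theta R$, $L_s\ge0$ is any finite upper bound on the local $\ell_\infty$-Lipschitz constant of $\psi_2$ on $\{A_\theta\psi_1(s):0\le\theta\le1\}$, i.e. $\|\psi_2(v)-\psi_2(w)\|_\infty\le L_s\|v-w\|_\infty$ for all $v,w$ in this set, and $B_T(R):=\frac2{|T|}\sum_{s\in T}L_s\|R\psi_1(s)\|_\infty$. Here $\odot$ is the entrywise product, $\|\cdot\|_F$ the Frobenius norm, $\|\cdot\|_1$ the entrywise $\ell_1$ norm, and $\|\cdot\|_\infty$ the vector maximum norm. *)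

theory Defs
  imports "HOL-Analysis.Analysis"
begin

text \<open>
  An n-by-m matrix is an element of \<open>real^'m^'n\<close>.  The type class instances of
  \<open>vec\<close> supply the matrix notions used below: \<open>*\<close> is the entrywise (Hadamard) product,
  not the matrix product \<open>**\<close>, and \<open>norm\<close> is the Frobenius norm.  The maximum norm of a
  vector is \<open>infnorm\<close>.  The next three lemmas record these readings.
\<close>

lemma matrix_times_entrywise:
  fixes A B :: "real^'m^'n"
  shows "A * B = (\<chi> i j. A $ i $ j * B $ i $ j)"
  by (simp add: vec_eq_iff)

lemma matrix_norm_frobenius:
  fixes A :: "real^'m^'n"
  shows "norm A = sqrt (\<Sum>i\<in>UNIV. \<Sum>j\<in>UNIV. (A $ i $ j)\<^sup>2)"
  by (simp add: norm_vec_def L2_set_def sum_nonneg)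

lemma infnorm_vec_Max:
  fixes x :: "real^'n"
  shows "infnorm x = Max (range (\<lambda>i. \<bar>x $ i\<bar>))"
  by (simp add: infnorm_cart cSup_eq_Max full_SetCompr_eq)

definition entry_l1_norm :: "real^'m^'n \<Rightarrow> real" where
  "entry_l1_norm A = (\<Sum>i\<in>UNIV. \<Sum>j\<in>UNIV. \<bar>A $ i $ j\<bar>)"

definition mask_decomposition ::
  "real^'m^'n \<Rightarrow> real^'m^'n \<Rightarrow> real^'m^'n \<Rightarrow> bool" where
  "mask_decomposition A S R \<longleftrightarrow> A = S + R \<and> S * R = 0"

definition path_layer :: "real^'m^'n \<Rightarrow> real^'m^'n \<Rightarrow> real \<Rightarrow> real^'m^'n" where
  "path_layer S R \<theta> = S + \<theta> *\<^sub>R R"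

definition logits ::
  "('s \<Rightarrow> real^'m) \<Rightarrow> (real^'n \<Rightarrow> real^'k) \<Rightarrow> real^'m^'n \<Rightarrow> 's \<Rightarrow> real^'k" where
  "logits \<psi>1 \<psi>2 A s = \<psi>2 (A *v \<psi>1 s)"

text \<open>The finite type \<open>'k\<close> is the set of classes.\<close>

definition cross_entropy ::
  "'s set \<Rightarrow> ('s \<Rightarrow> 'k) \<Rightarrow> ('s \<Rightarrow> real^'m) \<Rightarrow> (real^'n \<Rightarrow> real^'k) \<Rightarrow> real^'m^'n \<Rightarrow> real" where
  "cross_entropy T C \<psi>1 \<psi>2 A =
     1 / real (card T) *
       (\<Sum>s\<in>T. - (logits \<psi>1 \<psi>2 A s $ C s) + ln (\<Sum>j\<in>UNIV. exp (logits \<psi>1 \<psi>2 A s $ j)))"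

text \<open>The constant \<open>c\<close> collects the terms that do not depend on the layer \<open>A\<close>.\<close>

definition elastic_net_objective ::
  "'s set \<Rightarrow> ('s \<Rightarrow> 'k) \<Rightarrow> ('s \<Rightarrow> real^'m) \<Rightarrow> (real^'n \<Rightarrow> real^'k) \<Rightarrow>
   real \<Rightarrow> real \<Rightarrow> real \<Rightarrow> real^'m^'n \<Rightarrow> real" where
  "elastic_net_objective T C \<psi>1 \<psi>2 lam2 lam1 c A =
     cross_entropy T C \<psi>1 \<psi>2 A + lam2 * (norm A)\<^sup>2 + lam1 * entry_l1_norm A + c"

text \<open>
  The library's \<open>lipschitz_on\<close> refers to the Euclidean distance of \<open>real^'n\<close>; here both
  sides are measured in the maximum norm.
\<close>

definition linf_lipschitz_on :: "real \<Rightarrow> (real^'n) set \<Rightarrow> (real^'n \<Rightarrow> real^'k) \<Rightarrow> bool" where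
  "linf_lipschitz_on L X f \<longleftrightarrow>
     0 \<le> L \<and> (\<forall>v\<in>X. \<forall>w\<in>X. infnorm (f v - f w) \<le> L * infnorm (v - w))"

definition prune_bound ::
  "'s set \<Rightarrow> ('s \<Rightarrow> real^'m) \<Rightarrow> ('s \<Rightarrow> real) \<Rightarrow> real^'m^'n \<Rightarrow> real" where
  "prune_bound T \<psi>1 L R = 2 / real (card T) * (\<Sum>s\<in>T. L s * infnorm (R *v \<psi>1 s))"

end

theory Submission
  imports Defs
begin

text \<open>
  The map \<open>z \<mapsto> - z $ k + ln (\<Sum>j. exp (z $ j))\<close> is 2-Lipschitz for the maximum norm: each of its
  two summands is 1-Lipschitz.  Since the layers at \<open>\<theta>\<close> and at \<open>1\<close> differ by \<open>(1 - \<theta>) R\<close>, the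
  cross-entropy changes by at most \<open>(1 - \<theta>) B\<close>.  As the supports of \<open>S\<close> and \<open>R\<close> are disjoint, both
  penalties split exactly into an \<open>S\<close>-part and an \<open>R\<close>-part, and only the latter depends on \<open>\<theta>\<close>.
\<close>

lemma abs_component_le_infnorm: "\<bar>x $ i\<bar> \<le> infnorm x"
  for x :: "real^'n"
  by (simp add: infnorm_vec_Max)

text \<open>With \<open>d = infnorm (u - v)\<close>, each component of \<open>u\<close> is at most
  that of \<open>v\<close> plus \<open>d\<close>, so the sum of exponentials grows at most by the
  factor \<open>exp d\<close>, which \<open>ln\<close> turns into the summand \<open>d\<close>.
  Exchanging \<open>u\<close> and \<open>v\<close> gives the other direction.\<close>

lemma log_sum_exp_diff_le:
  fixes u v :: "real^'k"
  shows "ln (\<Sum>j\<in>UNIV. exp (u $ j)) - ln (\<Sum>j\<in>UNIV. exp (v $ j)) \<le> infnorm (u - v)"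
proof -
  have pos: "0 < (\<Sum>j\<in>UNIV. exp (w $ j))" for w :: "real^'k"
    by (intro sum_pos) auto
  have "(\<Sum>j\<in>UNIV. exp (u $ j)) \<le> (\<Sum>j\<in>UNIV. exp (infnorm (u - v)) * exp (v $ j))"
  proof (rule sum_mono)
    fix j
    have "u $ j \<le> infnorm (u - v) + v $ j"
      using abs_component_le_infnorm[of "u - v" j] by simp
    then show "exp (u $ j) \<le> exp (infnorm (u - v)) * exp (v $ j)"
      by (simp flip: exp_add)
  qed
  also have "\<dots> = exp (infnorm (u - v)) * (\<Sum>j\<in>UNIV. exp (v $ j))"
    by (simp add: sum_distrib_left)
  finally have "ln (\<Sum>j\<in>UNIV. exp (u $ j)) \<le> ln (exp (infnorm (u - v)) * (\<Sum>j\<in>UNIV. exp (v $ j)))"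
    using pos by (subst ln_le_cancel_iff) auto
  also have "\<dots> = infnorm (u - v) + ln (\<Sum>j\<in>UNIV. exp (v $ j))"
    using pos[of v] by (simp add: ln_mult)
  finally show ?thesis by simp
qed

lemma cross_entropy_diff_le:
  "cross_entropy T C \<psi>1 \<psi>2 A - cross_entropy T C \<psi>1 \<psi>2 A' \<le>
     2 / real (card T) * (\<Sum>s\<in>T. infnorm (\<psi>2 (A *v \<psi>1 s) - \<psi>2 (A' *v \<psi>1 s)))"
proof -
  let ?l = "\<lambda>A s. - (logits \<psi>1 \<psi>2 A s $ C s) + ln (\<Sum>j\<in>UNIV. exp (logits \<psi>1 \<psi>2 A s $ j))"
  let ?d = "\<lambda>s. infnorm (\<psi>2 (A *v \<psi>1 s) - \<psi>2 (A' *v \<psi>1 s))"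
  \<comment> \<open>One copy of \<open>?d s\<close> pays for the log-sum-exp term, the other for the
    logit of the correct class.\<close>
  have "?l A s - ?l A' s \<le> 2 * ?d s" for s
    using log_sum_exp_diff_le[of "logits \<psi>1 \<psi>2 A s" "logits \<psi>1 \<psi>2 A' s"]
      abs_component_le_infnorm[of "logits \<psi>1 \<psi>2 A s - logits \<psi>1 \<psi>2 A' s" "C s"]
    by (simp add: logits_def)
  then have "(\<Sum>s\<in>T. ?l A s - ?l A' s) \<le> (\<Sum>s\<in>T. 2 * ?d s)"
    by (intro sum_mono)
  then have "1 / real (card T) * (\<Sum>s\<in>T. ?l A s - ?l A' s) \<le> 1 / real (card T) * (\<Sum>s\<in>T. 2 * ?d s)"
    by (intro mult_left_mono) auto
  then show ?thesis
    unfolding cross_entropy_def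
    by (simp only: sum_subtractf right_diff_distrib flip: sum_distrib_left)
qed

lemma path_layer_diff: "path_layer S R a - path_layer S R b = (a - b) *\<^sub>R R"
  by (simp add: path_layer_def scaleR_diff_left)

text \<open>The Lipschitz bound is available only on the segment traced by the path, hence both
  parameters lie in \<open>{0..1}\<close>.\<close>

lemma cross_entropy_path_diff_le:
  assumes lip: "\<And>s. s \<in> T \<Longrightarrow>
      linf_lipschitz_on (L s) ((\<lambda>\<theta>. path_layer S R \<theta> *v \<psi>1 s) ` {0..1}) \<psi>2"
    and "a \<in> {0..1}" "b \<in> {0..1}"
  shows "cross_entropy T C \<psi>1 \<psi>2 (path_layer S R a) - cross_entropy T C \<psi>1 \<psi>2 (path_layer S R b)
    \<le> \<bar>a - b\<bar> * prune_bound T \<psi>1 L R"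
proof -
  let ?P = "path_layer S R"
  have "infnorm (\<psi>2 (?P a *v \<psi>1 s) - \<psi>2 (?P b *v \<psi>1 s)) \<le> \<bar>a - b\<bar> * (L s * infnorm (R *v \<psi>1 s))"
    if "s \<in> T" for s
  proof -
    have "infnorm (\<psi>2 (?P a *v \<psi>1 s) - \<psi>2 (?P b *v \<psi>1 s)) \<le> L s * infnorm (?P a *v \<psi>1 s - ?P b *v \<psi>1 s)"
      using lip[OF that] assms(2,3) unfolding linf_lipschitz_on_def by blast
    \<comment> \<open>By linearity \<open>S\<close> cancels, and the input of \<open>\<psi>2\<close>
      moves along the fixed vector \<open>R *v \<psi>1 s\<close>; \<open>infnorm\<close> then pulls
      out \<bar>a - b\<bar>.\<close>
    also have "?P a *v \<psi>1 s - ?P b *v \<psi>1 s = (a - b) *\<^sub>R (R *v \<psi>1 s)"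
      by (simp add: path_layer_diff scaleR_matrix_vector_assoc flip: matrix_vector_mult_diff_rdistrib)
    finally show ?thesis
      by (simp add: infnorm_mul mult_ac)
  qed
  then have "2 / real (card T) * (\<Sum>s\<in>T. infnorm (\<psi>2 (?P a *v \<psi>1 s) - \<psi>2 (?P b *v \<psi>1 s)))
      \<le> 2 / real (card T) * (\<Sum>s\<in>T. \<bar>a - b\<bar> * (L s * infnorm (R *v \<psi>1 s)))"
    by (intro mult_left_mono sum_mono) auto
  also have "\<dots> = \<bar>a - b\<bar> * prune_bound T \<psi>1 L R"
    by (simp add: prune_bound_def flip: sum_distrib_left)
  finally show ?thesis
    using cross_entropy_diff_le order_trans by blast
qed

text \<open>The reals have no zero divisors, so a vanishing entrywise product means disjoint
  supports.\<close>

lemma mask_entry: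
  assumes "S * R = 0"
  shows "S $ i $ j = 0 \<or> R $ i $ j = (0::real)"
  using assms by (simp add: vec_eq_iff)

text \<open>In the expanded square of each entry, the cross term contains
  \<open>S $ i $ j * R $ i $ j\<close> and therefore vanishes.\<close>

lemma norm_path_layer:
  fixes S R :: "real^'m^'n"
  assumes "S * R = 0"
  shows "(norm (path_layer S R \<theta>))\<^sup>2 = (norm S)\<^sup>2 + \<theta>\<^sup>2 * (norm R)\<^sup>2"
proof -
  have norm_sq: "(norm M)\<^sup>2 = (\<Sum>i\<in>UNIV. \<Sum>j\<in>UNIV. (M $ i $ j)\<^sup>2)" for M :: "real^'m^'n"
    by (simp add: matrix_norm_frobenius sum_nonneg)
  have "(path_layer S R \<theta> $ i $ j)\<^sup>2 = (S $ i $ j)\<^sup>2 + \<theta>\<^sup>2 * (R $ i $ j)\<^sup>2" for i j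
    using mask_entry[OF assms, of i j] by (auto simp: path_layer_def power_mult_distrib)
  then show ?thesis
    by (simp add: norm_sq sum.distrib sum_distrib_left)
qed

text \<open>At each entry at most one summand is nonzero, so the triangle inequality is an equality;
  the sign of \<theta> lets it leave the absolute value unchanged.\<close>

lemma entry_l1_norm_path_layer:
  assumes "S * R = 0" and "0 \<le> \<theta>"
  shows "entry_l1_norm (path_layer S R \<theta>) = entry_l1_norm S + \<theta> * entry_l1_norm R"
proof -
  have "\<bar>path_layer S R \<theta> $ i $ j\<bar> = \<bar>S $ i $ j\<bar> + \<theta> * \<bar>R $ i $ j\<bar>" for i j
    using mask_entry[OF assms(1), of i j] assms(2) by (auto simp: path_layer_def abs_mult)
  then show ?thesis
    by (simp add: entry_l1_norm_def sum.distrib sum_distrib_left)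
qed

theorem theorem5p4:
  fixes T :: "'s set" and C :: "'s \<Rightarrow> 'k::finite"
    and \<psi>1 :: "'s \<Rightarrow> real^'m::finite" and \<psi>2 :: "real^'n::finite \<Rightarrow> real^'k"
    and A S R :: "real^'m^'n" and L :: "'s \<Rightarrow> real" and lam2 lam1 c :: real
  defines "J \<equiv> elastic_net_objective T C \<psi>1 \<psi>2 lam2 lam1 c"
    and "B \<equiv> prune_bound T \<psi>1 L"
  assumes "finite T" and "T \<noteq> {}"
    and "mask_decomposition A S R"
    and "lam2 \<ge> 0" and "lam1 \<ge> 0"
    and "\<And>s. s \<in> T \<Longrightarrow>
           linf_lipschitz_on (L s) ((\<lambda>\<theta>. path_layer S R \<theta> *v \<psi>1 s) ` {0..1}) \<psi>2"
  shows "(\<forall>\<theta>\<in>{0..1}.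
            J (path_layer S R \<theta>) - J (path_layer S R 1)
              \<le> (1 - \<theta>) * B R - lam2 * (1 - \<theta>\<^sup>2) * (norm R)\<^sup>2 - lam1 * (1 - \<theta>) * entry_l1_norm R)
       \<and> J S \<le> J A - lam2 * (norm R)\<^sup>2 - lam1 * entry_l1_norm R + B R
       \<and> (B R < lam2 * (norm R)\<^sup>2 + lam1 * entry_l1_norm R \<longrightarrow> J S < J A)"
proof -
  let ?P = "path_layer S R"
  \<comment> \<open>The original layer and the fully pruned one are the two ends of the
    path.\<close>
  have A: "A = ?P 1" and S: "S = ?P 0" and SR: "S * R = 0"
    using assms(5) by (simp_all add: mask_decomposition_def path_layer_def)
  have main: "J (?P \<theta>) - J (?P 1)
      \<le> (1 - \<theta>) * B R - lam2 * (1 - \<theta>\<^sup>2) * (norm R)\<^sup>2 - lam1 * (1 - \<theta>) * entry_l1_norm R"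
    if "\<theta> \<in> {0..1}" for \<theta>
  proof -
    \<comment> \<open>On the unit interval the factor \<bar>\<theta> - 1\<bar> is 1 -
      \<theta>.\<close>
    have "cross_entropy T C \<psi>1 \<psi>2 (?P \<theta>) - cross_entropy T C \<psi>1 \<psi>2 (?P 1) \<le> (1 - \<theta>) * B R"
      using cross_entropy_path_diff_le[of T L S R \<psi>1 \<psi>2 \<theta> 1 C, OF assms(8)] that
      by (simp add: B_def abs_if split: if_splits)
    \<comment> \<open>In the difference of objectives the penalties of \<open>S\<close> and the
      constant \<open>c\<close> cancel. The penalties of \<open>R\<close> leave exact terms, so only
      the cross-entropy contributes an inequality.\<close>
    then show ?thesis
      using that
      by (simp add: J_def elastic_net_objective_def norm_path_layer[OF SR]
          entry_l1_norm_path_layer[OF SR] algebra_simps)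
  qed
  have "J S \<le> J A - lam2 * (norm R)\<^sup>2 - lam1 * entry_l1_norm R + B R"
    using main[of 0] A S by simp
  with main show ?thesis by auto
qed

end
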